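(* Let $\kappa$ be a regular uncountable cardinal and let $S\subseteq\kappa$ be a stationary subset of $\kappa$ consisting only of ordinals of cofinality $\omega$. Then any tree-decomposition of $G(S)$ has a part of size $\kappa$ (for any choice of the cofinal sequences $f_s\colon\omega\to s$, $s\in S$, used to define $G(S)$).
   Context: Graphs are simple, undirected and possibly infinite. The graph $G(S)$: Let $\kappa$ be an uncountable cardinal. Let $S\subseteq\kappa$ be a set consisting only of ordinals of cofinality $\omega$, and for each $s\in S$ choose a cofinal sequence $f_s\colon\omega\to s$ (i.e. a function whose range is unbounded in $s$). Let $F(S)=\{f_s : s\in S\}$, a collection of $\omega$-sequences of elements of $\kappa$. The graph $G(S)$ (which depends also on the choice of the sequences $f_s$) has as vertex set $T^S$ the set of all finite sequences of elements of $\kappa$ (including the empty sequence) together with all elements of $F(S)$. Its edges are as follows: each finite sequence of length $n$ is adjacent to all sequences of length $n+1$ extending it, and each $f_s\in F(S)$ is adjacent to all of its finite initial segments (including the empty sequence); there are no other edges. A subset $A\subseteq\kappa$ is unbounded if $\sup A=\kappa$, and closed if $\sup(A\cap\ell)=\ell$ implies $\ell\in A$ for all limit ordinals $\ell<\kappa$; it is a club if it is closed and unbounded. A subset $S\subseteq\kappa$ is stationary if it meets every club of $\kappa$. A tree-decomposition of a graph $G$ is a pair $(Q,(V_q)_{q\in Q})$ consisting of a (possibly infinite) graph-theoretic tree $Q$ and a family of vertex sets $V_q\subseteq V(G)$, called its parts, such that $V(G)=\bigcup_{q\in Q}V_q$; every edge of $G$ has both its ends in a common $V_q$; and whenever $q_2$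 lies on the path in $Q$ between $q_1$ and $q_3$, we have $V_{q_1}\cap V_{q_3}\subseteq V_{q_2}$. *)

theory Defs
  imports Main
begin

unbundle cardinal_syntax

subsection \<open>Ordinals below a cardinal\<close>

text \<open>
  A cardinal is a relation \<open>r\<close> with \<^term>\<open>Card_order r\<close>; the ordinals below it are the elements
  of \<^term>\<open>Field r\<close>. For \<open>a \<in> Field r\<close>, the ordinal \<open>a\<close> is itself the well-order \<open>seg r a\<close>, whose
  field \<^term>\<open>underS r a\<close> consists of the ordinals smaller than \<open>a\<close>. For a set \<open>A\<close> of ordinals
  smaller than \<open>a\<close>, \<^term>\<open>cofinal A (Restr r (underS r a))\<close> says that every ordinal smaller than
  \<open>a\<close> is strictly below some element of \<open>A\<close>, that is, \<open>sup A = a\<close>. In the same way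
  \<^term>\<open>cofinal A r\<close> says that the supremum of \<open>A\<close> is the cardinal \<open>r\<close>.
\<close>

abbreviation seg :: "'a rel \<Rightarrow> 'a \<Rightarrow> 'a rel" where
  "seg r a \<equiv> Restr r (underS r a)"

definition limit_ordinal :: "'a rel \<Rightarrow> 'a \<Rightarrow> bool" where
  "limit_ordinal r a \<longleftrightarrow> a \<in> Field r \<and> underS r a \<noteq> {} \<and>
     \<not> (\<exists>b\<in>underS r a. \<forall>c\<in>underS r a. (c, b) \<in> r)"

text \<open>
  The cofinality of a limit ordinal is the least cardinality of an unbounded subset. As \<^const>\<open>cofinal\<close>
  is strict, a successor ordinal has no cofinal subset, hence no cofinality in the sense below
  (conventionally it would be \<open>1\<close>); this makes no difference for infinite cofinalities.
\<close>

definition has_cofinality :: "'a rel \<Rightarrow> 'a \<Rightarrow> 'c rel \<Rightarrow> bool" where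
  "has_cofinality r a c \<longleftrightarrow>
     (\<exists>A\<subseteq>underS r a. cofinal A (seg r a) \<and> |A| =o c) \<and>
     (\<forall>A\<subseteq>underS r a. cofinal A (seg r a) \<longrightarrow> c \<le>o |A| )"

definition closed_in :: "'a rel \<Rightarrow> 'a set \<Rightarrow> bool" where
  "closed_in r A \<longleftrightarrow>
     (\<forall>l. limit_ordinal r l \<longrightarrow> cofinal (A \<inter> underS r l) (seg r l) \<longrightarrow> l \<in> A)"

definition club :: "'a rel \<Rightarrow> 'a set \<Rightarrow> bool" where
  "club r A \<longleftrightarrow> A \<subseteq> Field r \<and> closed_in r A \<and> cofinal A r"

definition stationary :: "'a rel \<Rightarrow> 'a set \<Rightarrow> bool" where
  "stationary r S \<longleftrightarrow> S \<subseteq> Field r \<and> (\<forall>C. club r C \<longrightarrow> S \<inter> C \<noteq> {})"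

definition cofinal_sequence :: "'a rel \<Rightarrow> 'a \<Rightarrow> (nat \<Rightarrow> 'a) \<Rightarrow> bool" where
  "cofinal_sequence r a g \<longleftrightarrow> range g \<subseteq> underS r a \<and> cofinal (range g) (seg r a)"


subsection \<open>Graphs, trees and tree-decompositions\<close>

record 'v ugraph =
  verts :: "'v set"
  edges :: "'v set set"

definition simple_graph :: "'v ugraph \<Rightarrow> bool" where
  "simple_graph G \<longleftrightarrow>
     (\<forall>e\<in>edges G. \<exists>u\<in>verts G. \<exists>v\<in>verts G. u \<noteq> v \<and> e = {u, v})"

text \<open>Paths and cycles are given by their lists of vertices.\<close>

definition is_path :: "'v ugraph \<Rightarrow> 'v \<Rightarrow> 'v list \<Rightarrow> 'v \<Rightarrow> bool" where
  "is_path G u p v \<longleftrightarrow> p \<noteq> [] \<and> hd p = u \<and> last p = v \<and> distinct p \<and> set p \<subseteq> verts G \<and>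
     successively (\<lambda>x y. {x, y} \<in> edges G) p"

definition is_cycle :: "'v ugraph \<Rightarrow> 'v list \<Rightarrow> bool" where
  "is_cycle G p \<longleftrightarrow> length p \<ge> 3 \<and> is_path G (hd p) p (last p) \<and> {last p, hd p} \<in> edges G"

definition connected_graph :: "'v ugraph \<Rightarrow> bool" where
  "connected_graph G \<longleftrightarrow> verts G \<noteq> {} \<and> (\<forall>u\<in>verts G. \<forall>v\<in>verts G. \<exists>p. is_path G u p v)"

definition is_tree :: "'v ugraph \<Rightarrow> bool" where
  "is_tree G \<longleftrightarrow> simple_graph G \<and> connected_graph G \<and> \<not> (\<exists>p. is_cycle G p)"

definition tree_decomposition :: "'v ugraph \<Rightarrow> 'q ugraph \<Rightarrow> ('q \<Rightarrow> 'v set) \<Rightarrow> bool" where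
  "tree_decomposition G Q V \<longleftrightarrow> is_tree Q \<and>
     verts G = (\<Union>q\<in>verts Q. V q) \<and>
     (\<forall>e\<in>edges G. \<exists>q\<in>verts Q. e \<subseteq> V q) \<and>
     (\<forall>q1 q2 q3 p. is_path Q q1 p q3 \<and> q2 \<in> set p \<longrightarrow> V q1 \<inter> V q3 \<subseteq> V q2)"


subsection \<open>The graph of a set of ordinals of countable cofinality\<close>

datatype 'a vertex = FinSeq "'a list" | OmegaSeq "nat \<Rightarrow> 'a"

text \<open>The list \<^term>\<open>map (f s) [0..<n]\<close> is the initial segment of length \<open>n\<close> of the sequence \<^term>\<open>f s\<close>.\<close>

definition GS :: "'a rel \<Rightarrow> 'a set \<Rightarrow> ('a \<Rightarrow> nat \<Rightarrow> 'a) \<Rightarrow> 'a vertex ugraph" where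
  "GS r S f = \<lparr>
     verts = FinSeq ` lists (Field r) \<union> OmegaSeq ` f ` S,
     edges = {{FinSeq xs, FinSeq (xs @ [a])} | xs a. xs \<in> lists (Field r) \<and> a \<in> Field r}
           \<union> {{OmegaSeq (f s), FinSeq (map (f s) [0..<n])} | s n. s \<in> S} \<rparr>"

lemma simple_graph_GS:
  assumes "\<And>s. s \<in> S \<Longrightarrow> range (f s) \<subseteq> Field r"
  shows "simple_graph (GS r S f)"
proof -
  have init: "map (f s) [0..<n] \<in> lists (Field r)" if "s \<in> S" for s n
    using assms[OF that] by (auto simp: in_lists_conv_set)
  show ?thesis
    unfolding simple_graph_def
  proof
    fix e assume "e \<in> edges (GS r S f)"
    then consider
      (ext) xs a where "xs \<in> lists (Field r)" "a \<in> Field r" "e = {FinSeq xs, FinSeq (xs @ [a])}"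
    | (init) s n where "s \<in> S" "e = {OmegaSeq (f s), FinSeq (map (f s) [0..<n])}"
      unfolding GS_def by auto
    then show "\<exists>u\<in>verts (GS r S f). \<exists>v\<in>verts (GS r S f). u \<noteq> v \<and> e = {u, v}"
    proof cases
      case ext
      then show ?thesis
        by (intro bexI[of _ "FinSeq xs"] bexI[of _ "FinSeq (xs @ [a])"]) (auto simp: GS_def)
    next
      case init
      then show ?thesis
        using \<open>\<And>s n. s \<in> S \<Longrightarrow> map (f s) [0..<n] \<in> lists (Field r)\<close>[OF init(1), of n]
        by (intro bexI[of _ "OmegaSeq (f s)"] bexI[of _ "FinSeq (map (f s) [0..<n])"])
          (auto simp: GS_def simp del: in_lists_conv_set)
    qed
  qed
qed

end

theory Submission
  imports Defs
begin

text \<open>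
  Suppose that every part of a tree-decomposition \<open>(Q, V)\<close> of \<open>G(S)\<close> has fewer than \<open>\<kappa>\<close> elements.
  Root \<open>Q\<close> at a vertex \<open>q0\<close> and choose, for each finite sequence \<open>x\<close>, a path \<open>P x\<close> from \<open>q0\<close> to a
  vertex whose part contains \<open>x\<close>. For an ordinal \<open>a\<close> below \<open>\<kappa>\<close>, the union \<open>T a\<close> of the paths \<open>P x\<close>
  for sequences \<open>x\<close> of ordinals below \<open>a\<close> is connected and has fewer than \<open>\<kappa>\<close> vertices; by
  regularity so has the union \<open>X a\<close> of its parts. Since finite sequences below an ordinal of
  cofinality \<open>\<omega>\<close> are already bounded below it, \<open>T\<close> and \<open>X\<close> are continuous at the members of \<open>S\<close>.

  Let \<open>E a\<close> be the set of all entries of finite sequences in \<open>X a\<close> together with all \<open>t\<close> with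
  \<open>f\<^sub>t \<in> X a\<close>. It has fewer than \<open>\<kappa>\<close> elements, hence a least strict upper bound below \<open>\<kappa>\<close>. The ordinals
  closed under the map sending \<open>a\<close> to that bound form a club (\<open>club_closure_points\<close>), so one of
  them, \<open>s\<close>, lies in \<open>S\<close>. Then \<open>f\<^sub>s \<notin> X s\<close>: otherwise \<open>f\<^sub>s \<in> X a\<close> for some \<open>a < s\<close>, so the
  bound of \<open>E a\<close> would exceed \<open>s\<close>.

  On the other hand all initial segments of \<open>f\<^sub>s\<close> lie in \<open>X s\<close>, and each shares a part with \<open>f\<^sub>s\<close>.
  The vertices of \<open>Q\<close> whose parts contain \<open>f\<^sub>s\<close> are connected outside \<open>T s\<close>, so a single vertex \<open>q\<close>
  of \<open>T s\<close> separates them from \<open>T s\<close> (\<open>gate_separates\<close>), and \<open>V q\<close> contains every initial segment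
  of \<open>f\<^sub>s\<close>. But \<open>q \<in> T a\<close> for some \<open>a < s\<close>, so all values of \<open>f\<^sub>s\<close> belong to \<open>E a\<close> and are bounded
  below \<open>s\<close>, contradicting that \<open>f\<^sub>s\<close> is cofinal in \<open>s\<close>.
\<close>

section \<open>Separation in tree-decompositions\<close>

text \<open>Connection by walks inside \<open>W\<close>. Unlike paths, walks can be concatenated without regard to
  repeated vertices. The relation is reflexive everywhere, so the pair \<open>(x, x)\<close> does not say that
  \<open>x\<close> lies in \<open>W\<close>.\<close>

definition joined :: "'v ugraph \<Rightarrow> 'v set \<Rightarrow> 'v rel" where
  "joined G W = {(x, y). x \<in> W \<and> y \<in> W \<and> {x, y} \<in> edges G}\<^sup>*"

lemma joined_sym: "(x, y) \<in> joined G W \<Longrightarrow> (y, x) \<in> joined G W"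
proof -
  have "sym {(x, y). x \<in> W \<and> y \<in> W \<and> {x, y} \<in> edges G}"
    by (auto simp: sym_def insert_commute)
  then show "(x, y) \<in> joined G W \<Longrightarrow> (y, x) \<in> joined G W"
    unfolding joined_def by (meson sym_rtrancl symD)
qed

lemma joined_trans: "(x, y) \<in> joined G W \<Longrightarrow> (y, z) \<in> joined G W \<Longrightarrow> (x, z) \<in> joined G W"
  unfolding joined_def by simp

lemma successively_joined_hd:
  assumes "successively (\<lambda>x y. {x, y} \<in> edges G) p" "set p \<subseteq> W" "x \<in> set p"
  shows "(hd p, x) \<in> joined G W"
  using assms
proof (induction p)
  case (Cons a p)
  show ?case
  proof (cases "x = a")
    case False
    then have x: "x \<in> set p" and "p \<noteq> []" using Cons.prems by auto
    then have "{a, hd p} \<in> edges G" "successively (\<lambda>x y. {x, y} \<in> edges G) p"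
      using Cons.prems(1) by (auto simp: successively_Cons)
    moreover have "hd p \<in> W" using \<open>p \<noteq> []\<close> Cons.prems(2) by (cases p) auto
    ultimately show ?thesis
      using Cons.IH x Cons.prems(2) unfolding joined_def
      by (auto intro: converse_rtrancl_into_rtrancl)
  qed (simp add: joined_def)
qed simp

text \<open>Loop erasure: when a walk returns to a vertex of the path built so far, that path is cut off
  at this vertex.\<close>

lemma joined_imp_path:
  assumes "(a, b) \<in> joined G W" "a \<in> W" "W \<subseteq> verts G"
  obtains p where "is_path G a p b" "set p \<subseteq> W"
proof -
  have "\<exists>p. is_path G a p b \<and> set p \<subseteq> W"
    using assms(1) unfolding joined_def
  proof (induction rule: rtrancl_induct)
    case base
    show ?case using assms by (intro exI[of _ "[a]"]) (auto simp: is_path_def)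
  next
    case (step c d)
    then obtain p where p: "is_path G a p c" "set p \<subseteq> W" by blast
    show ?case
    proof (cases "d \<in> set p")
      case True
      then obtain ys zs where s: "p = (ys @ [d]) @ zs"
        by (metis split_list append_Cons append_Nil append_assoc)
      show ?thesis
        using p unfolding s is_path_def
        by (intro exI[of _ "ys @ [d]"]) (auto simp: successively_append_iff hd_append)
    next
      case False
      show ?thesis
        using p step.hyps(2) False assms(3) unfolding is_path_def
        by (intro exI[of _ "p @ [d]"]) (auto simp: successively_append_iff)
    qed
  qed
  then show ?thesis using that by blast
qed

lemma tree_decompositionD:
  assumes "tree_decomposition G Q V"
  shows "verts Q \<noteq> {}" "\<And>u v. u \<in> verts Q \<Longrightarrow> v \<in> verts Q \<Longrightarrow> \<exists>p. is_path Q u p v"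
    "verts G = (\<Union>q\<in>verts Q. V q)" "\<And>e. e \<in> edges G \<Longrightarrow> \<exists>q\<in>verts Q. e \<subseteq> V q"
    "\<And>b p d q. is_path Q b p d \<Longrightarrow> q \<in> set p \<Longrightarrow> V b \<inter> V d \<subseteq> V q"
  using assms unfolding tree_decomposition_def is_tree_def connected_graph_def by simp_all blast

text \<open>
  The gate \<open>q\<close> is the last vertex in \<open>P\<close> of some path that leads from \<open>P\<close> to \<open>b\<close>. A path inside \<open>P\<close>
  ending in \<open>q\<close>, continued along the next edge of that path and then outside \<open>P\<close>, is again a path,
  because its two pieces are disjoint; so the third axiom of a tree-decomposition applies to it at
  \<open>q\<close>. One gate serves everything that is connected to \<open>b\<close> outside \<open>P\<close>.
\<close>

lemma gate_separates:
  assumes td: "tree_decomposition G Q V" and P: "P \<subseteq> verts Q"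
    and conn: "\<And>u v. u \<in> P \<Longrightarrow> v \<in> P \<Longrightarrow> (u, v) \<in> joined Q P"
    and "P \<noteq> {}" and b: "b \<in> verts Q - P"
  obtains q where "q \<in> P"
    "\<And>c d. c \<in> P \<Longrightarrow> (b, d) \<in> joined Q (verts Q - P) \<Longrightarrow> V c \<inter> V d \<subseteq> V q"
proof -
  obtain a where a: "a \<in> P" using \<open>P \<noteq> {}\<close> by blast
  obtain p where p: "is_path Q a p b"
    using tree_decompositionD(2)[OF td, of a b] a b P by blast
  then have "\<exists>x\<in>set p. x \<in> P" using a by (metis is_path_def hd_in_set)
  then obtain ys q zs where s: "p = ys @ q # zs" "q \<in> P" "\<forall>z\<in>set zs. z \<notin> P"
    using split_list_last_prop[of p "\<lambda>x. x \<in> P"] by blast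
  have zs: "zs \<noteq> []" "last zs = b" using s p b unfolding is_path_def by auto
  have succ: "{q, hd zs} \<in> edges Q" "successively (\<lambda>x y. {x, y} \<in> edges Q) zs"
    "set zs \<subseteq> verts Q - P"
    using p s zs unfolding is_path_def
    by (auto simp: successively_append_iff successively_Cons)
  then have hb: "(hd zs, b) \<in> joined Q (verts Q - P)" "hd zs \<in> verts Q - P"
    using successively_joined_hd zs by (metis last_in_set, metis hd_in_set subsetD)
  have "V c \<inter> V d \<subseteq> V q" if c: "c \<in> P" and d: "(b, d) \<in> joined Q (verts Q - P)" for c d
  proof -
    obtain u where u: "is_path Q c u q" "set u \<subseteq> P"
      using joined_imp_path[OF conn[OF c s(2)] c P] by blast
    obtain t where t: "is_path Q (hd zs) t d" "set t \<subseteq> verts Q - P"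
      using joined_imp_path[OF joined_trans[OF hb(1) d] hb(2)] by blast
    have "is_path Q c (u @ t) d"
      using u t succ(1) unfolding is_path_def by (auto simp: successively_append_iff)
    moreover have "q \<in> set (u @ t)" using u unfolding is_path_def by auto
    ultimately show ?thesis by (rule tree_decompositionD(5)[OF td])
  qed
  then show ?thesis using that s(2) by blast
qed

text \<open>The parts containing a fixed vertex \<open>v\<close> are connected in \<open>Q\<close>, hence connected outside any \<open>P\<close>
  whose parts all miss \<open>v\<close>.\<close>

lemma joined_outside:
  assumes td: "tree_decomposition G Q V" and v: "v \<in> V b" "v \<in> V d" "b \<in> verts Q" "d \<in> verts Q"
    and out: "\<And>q. q \<in> P \<Longrightarrow> v \<notin> V q"
  shows "(b, d) \<in> joined Q (verts Q - P)"
proof -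
  obtain p where p: "is_path Q b p d"
    using tree_decompositionD(2)[OF td] v(3,4) by blast
  have "v \<in> V q" if "q \<in> set p" for q
    using tree_decompositionD(5)[OF td p that] v(1,2) by blast
  then have "set p \<subseteq> verts Q - P" using p out unfolding is_path_def by blast
  then show ?thesis using successively_joined_hd p unfolding is_path_def by (metis last_in_set)
qed


section \<open>Regular uncountable cardinals\<close>

text \<open>The well-order \<open>\<kappa>\<close> is treated through the strict initial segments \<open>underS\<close>: \<open>a \<in> underS b\<close>
  is the strict order \<open>a < b\<close>, and \<open>suc A\<close> is the least strict upper bound of \<open>A\<close>.\<close>

locale regular_uncountable =
  fixes \<kappa> :: "'a rel"
  assumes card: "Card_order \<kappa>" and unc: "natLeq <o \<kappa>" and reg: "regularCard \<kappa>"
begin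

sublocale wo_rel \<kappa>
  unfolding wo_rel_def using card_order_on_well_order_on[OF card] .

lemma infinite_Field: "infinite (Field \<kappa>)"
  using ordLeq_ordIso_trans[OF ordLess_imp_ordLeq[OF unc]
      ordIso_symmetric[OF card_of_Field_ordIso[OF card]]]
  using infinite_iff_natLeq_ordLeq[of "Field \<kappa>"] by blast

lemma stable: "stable \<kappa>"
  using regularCard_stable[OF card infinite_Field reg] .

lemma underS_sub: "underS a \<subseteq> Field \<kappa>"
  by (rule Order_Relation.underS_Field)

lemma underS_trans: "a \<in> underS b \<Longrightarrow> b \<in> underS c \<Longrightarrow> a \<in> underS c"
  using TRANS ANTISYM unfolding underS_def trans_def antisym_def by blast

lemma underS_cases:
  "a \<in> Field \<kappa> \<Longrightarrow> b \<in> Field \<kappa> \<Longrightarrow> a = b \<or> a \<in> underS b \<or> b \<in> underS a"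
  using TOTALS unfolding underS_def by blast

lemma underS_asym: "a \<in> underS b \<Longrightarrow> b \<notin> underS a"
  using ANTISYM unfolding underS_def antisym_def by blast

lemma countable_small: "|range (g :: nat \<Rightarrow> 'b)| <o \<kappa>"
  using ordLeq_ordLess_trans[OF card_of_image]
    ordIso_ordLess_trans[OF card_of_nat unc] by blast

lemma finite_small: "finite A \<Longrightarrow> |A| <o \<kappa>"
  using ordLess_transitive[OF _ unc] by (simp add: finite_iff_ordLess_natLeq)

text \<open>There are countably many lengths, and lists of length \<open>n + 1\<close> are indexed by their heads and
  their tails of length \<open>n\<close>; regularity bounds both unions.\<close>

lemma lists_small:
  assumes "|A| <o \<kappa>"
  shows "|lists A| <o \<kappa>"
proof -
  have len: "|{xs \<in> lists A. length xs = n}| <o \<kappa>" for n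
  proof (induction n)
    case 0
    then show ?case by (intro finite_small) (auto intro: finite_subset[of _ "{[]}"])
  next
    case (Suc n)
    have "{xs \<in> lists A. length xs = Suc n}
        = (\<Union>a\<in>A. (#) a ` {xs \<in> lists A. length xs = n})"
      by (auto simp: length_Suc_conv image_iff)
    then show ?case
      using stable_UNION[OF stable assms ordLeq_ordLess_trans[OF card_of_image Suc.IH]] by simp
  qed
  have "lists A = (\<Union>n\<in>range id. {xs \<in> lists A. length xs = n})" by auto
  then show ?thesis using stable_UNION[OF stable countable_small len, of id "\<lambda>x. x"] by simp
qed

text \<open>Regularity only denies that \<open>A\<close> is cofinal, which gives a bound that may belong to \<open>A\<close>; the
  bound becomes strict because an infinite cardinal has no largest element.\<close>

lemma small_bounded:
  assumes "A \<subseteq> Field \<kappa>" "|A| <o \<kappa>"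
  shows "AboveS A \<noteq> {}"
proof -
  have "\<not> cofinal A \<kappa>"
    using assms reg not_ordLess_ordIso unfolding regularCard_def by blast
  then obtain a where a: "a \<in> Field \<kappa>" "\<And>b. b \<in> A \<Longrightarrow> \<not> a \<in> underS b"
    unfolding cofinal_def underS_def by blast
  obtain c where c: "c \<in> Field \<kappa>" "a \<in> underS c"
    using infinite_Card_order_limit[OF card infinite_Field a(1)] unfolding underS_def by blast
  have "b \<in> underS c" if "b \<in> A" for b
    using underS_cases[of b a] a that assms(1) c(2) underS_trans by blast
  then show ?thesis using c(1) unfolding AboveS_def underS_def by blast
qed

text \<open>A finite set of ordinals below \<open>\<kappa>\<close> is bounded below \<open>\<kappa>\<close>, so the lists form a union of \<open>\<kappa>\<close>
  many sets of fewer than \<open>\<kappa>\<close> elements each.\<close>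

lemma lists_Field: "|lists (Field \<kappa>)| \<le>o \<kappa>"
proof -
  have F: "|Field \<kappa>| \<le>o \<kappa>" using ordIso_imp_ordLeq[OF card_of_Field_ordIso[OF card]] .
  have "\<exists>a\<in>Field \<kappa>. xs \<in> lists (underS a)" if "set xs \<subseteq> Field \<kappa>" for xs
    using small_bounded[OF that finite_small[OF finite_set]] by (auto simp: AboveS_def underS_def)
  then have "lists (Field \<kappa>) \<subseteq> (\<Union>a\<in>Field \<kappa>. lists (underS a))" by (auto simp: subset_iff)
  moreover have "|\<Union>a\<in>Field \<kappa>. lists (underS a)| \<le>o \<kappa>"
    by (rule card_of_UNION_ordLeq_infinite_Field[OF infinite_Field card F])
      (simp add: ordLess_imp_ordLeq lists_small card_of_underS[OF card])
  ultimately show ?thesis using ordLeq_transitive[OF card_of_mono1] by blast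
qed

lemma small_below_suc:
  assumes "A \<subseteq> Field \<kappa>" "|A| <o \<kappa>"
  shows "suc A \<in> Field \<kappa>" "a \<in> A \<Longrightarrow> a \<in> underS (suc A)"
  using suc_inField[OF assms(1) small_bounded[OF assms]]
    suc_greater[OF assms(1) small_bounded[OF assms]] unfolding underS_def by auto

lemma below_suc:
  assumes "A \<subseteq> Field \<kappa>" "a \<in> underS (suc A)"
  shows "\<exists>b\<in>A. a = b \<or> a \<in> underS b"
proof (rule ccontr)
  assume *: "\<not> ?thesis"
  have a: "a \<in> Field \<kappa>" using assms(2) underS_sub by blast
  have "b \<in> underS a" if "b \<in> A" for b
    using underS_cases[OF a, of b] * that assms(1) by blast
  then have "a \<in> AboveS A" using a unfolding AboveS_def underS_def by blast
  then have "(suc A, a) \<in> \<kappa>" by (rule suc_least_AboveS)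
  then show False using assms(2) ANTISYM unfolding underS_def antisym_def by blast
qed

lemma cofinal_seg_iff:
  "cofinal A (seg \<kappa> l) \<longleftrightarrow> (\<forall>a\<in>underS l. \<exists>b\<in>A \<inter> underS l. a \<in> underS b)"
proof -
  have "Field (seg \<kappa> l) = underS l"
    using Refl_Field_Restr2[OF REFL underS_sub] .
  then show ?thesis unfolding cofinal_def by (auto simp: underS_def)
qed

text \<open>
  For unboundedness, start at \<open>a\<close> and alternate between taking all values of \<open>h\<close> and bounding
  them. After \<open>\<omega>\<close> steps the supremum is closed under \<open>h\<close>; it is still below \<open>\<kappa>\<close> because \<open>\<kappa>\<close> is
  regular and uncountable.
\<close>

lemma club_closure_points:
  assumes h: "\<And>a. a \<in> Field \<kappa> \<Longrightarrow> h a \<in> Field \<kappa>"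
  shows "club \<kappa> {l \<in> Field \<kappa>. h ` underS l \<subseteq> underS l}" (is "club \<kappa> ?C")
  unfolding club_def
proof (intro conjI)
  show "closed_in \<kappa> ?C"
    unfolding closed_in_def cofinal_seg_iff
  proof (intro allI impI)
    fix l assume lim: "limit_ordinal \<kappa> l"
      and cof: "\<forall>a\<in>underS l. \<exists>b\<in>?C \<inter> underS l \<inter> underS l. a \<in> underS b"
    have "h a \<in> underS l" if a: "a \<in> underS l" for a
    proof -
      obtain b where b: "b \<in> ?C" "b \<in> underS l" "a \<in> underS b" using cof a by blast
      then have "h a \<in> underS b" by blast
      then show ?thesis using b(2) underS_trans by blast
    qed
    then show "l \<in> ?C" using lim unfolding limit_ordinal_def by blast
  qed
  show "cofinal ?C \<kappa>"
    unfolding cofinal_def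
  proof
    fix a assume a: "a \<in> Field \<kappa>"
    \<comment> \<open>The values at all ordinals up to \<open>b\<close> are bounded, since \<open>h\<close> may fail to be monotone.\<close>
    define step where "step b = suc (insert b (h ` under b))" for b
    define g where "g n = (step ^^ n) a" for n
    have step: "step b \<in> Field \<kappa>" "b \<in> underS (step b)" "h ` under b \<subseteq> underS (step b)"
      if b: "b \<in> Field \<kappa>" for b
    proof -
      let ?B = "insert b (h ` under b)"
      have u: "insert b (h ` under b) = {b, h b} \<union> h ` underS b"
        using Refl_under_underS[OF REFL b] by auto
      have s: "?B \<subseteq> Field \<kappa>" using b h under_Field[of \<kappa> b] by auto
      have "|h ` underS b| <o \<kappa>"
        using ordLeq_ordLess_trans[OF card_of_image card_of_underS[OF card b]] .
      then have "|?B| <o \<kappa>"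
        unfolding u
        by (intro card_of_Un_ordLess_infinite_Field[OF infinite_Field card finite_small]) auto
      from small_below_suc[OF s this] show "step b \<in> Field \<kappa>" "b \<in> underS (step b)"
        "h ` under b \<subseteq> underS (step b)"
        unfolding step_def by auto
    qed
    have gF: "g n \<in> Field \<kappa>" for n by (induction n) (use a step in \<open>auto simp: g_def\<close>)
    have gS: "g (Suc n) = step (g n)" for n by (simp add: g_def)
    let ?l = "suc (range g)"
    have sub: "range g \<subseteq> Field \<kappa>" using gF by auto
    have l: "?l \<in> Field \<kappa>" "\<And>n. g n \<in> underS ?l"
      using small_below_suc[OF sub countable_small] by auto
    have "h b \<in> underS ?l" if b: "b \<in> underS ?l" for b
    proof -
      obtain n where "b = g n \<or> b \<in> underS (g n)"
        using below_suc[OF sub b] by blast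
      then have "b \<in> under (g n)"
        using Refl_under_underS[OF REFL gF] by blast
      then have "h b \<in> underS (g (Suc n))" using step(3)[OF gF] gS by auto
      then show ?thesis using l(2) underS_trans by blast
    qed
    then have "?l \<in> ?C" using l(1) by blast
    moreover have "a \<in> underS ?l" using l(2)[of 0] by (simp add: g_def)
    ultimately show "\<exists>b\<in>?C. a \<noteq> b \<and> (a, b) \<in> \<kappa>" unfolding underS_def by blast
  qed
qed auto

lemma stationary_closure_point:
  assumes "stationary \<kappa> S" and "\<And>a. a \<in> Field \<kappa> \<Longrightarrow> h a \<in> Field \<kappa>"
  shows "\<exists>s\<in>S. h ` underS s \<subseteq> underS s"
proof -
  have "S \<inter> {l \<in> Field \<kappa>. h ` underS l \<subseteq> underS l} \<noteq> {}"
    using assms(1) club_closure_points[OF assms(2)] unfolding stationary_def by simp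
  then show ?thesis by blast
qed

lemma cofinal_sequence_above:
  assumes "cofinal_sequence \<kappa> s g"
  shows "g n \<in> underS s" "a \<in> underS s \<Longrightarrow> \<exists>n. a \<in> underS (g n)"
  using assms unfolding cofinal_sequence_def cofinal_seg_iff by auto

text \<open>A sequence determines the ordinal in which it is cofinal: if \<open>s < t\<close>, cofinality in \<open>t\<close> gives
  a value above \<open>s\<close>, whereas all values lie below \<open>s\<close>.\<close>

lemma cofinal_sequence_inj:
  assumes "cofinal_sequence \<kappa> s g" "cofinal_sequence \<kappa> t g" "s \<in> Field \<kappa>" "t \<in> Field \<kappa>"
  shows "s = t"
  using underS_cases[OF assms(3,4)] cofinal_sequence_above[OF assms(1)]
    cofinal_sequence_above[OF assms(2)] underS_asym by blast

text \<open>This gives continuity at \<open>s\<close>: an ordinal with a cofinal sequence is a limit, so the finitely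
  many entries of a list below \<open>s\<close> have a common strict bound below \<open>s\<close>.\<close>

lemma list_bounded_below:
  assumes "cofinal_sequence \<kappa> s g" "set xs \<subseteq> underS s"
  obtains a where "a \<in> underS s" "set xs \<subseteq> underS a"
proof -
  have "\<exists>a\<in>underS s. set xs \<subseteq> underS a"
    using assms(2)
  proof (induction xs)
    case Nil
    then show ?case using cofinal_sequence_above(1)[OF assms(1)] by auto
  next
    case (Cons x xs)
    then obtain a where a: "a \<in> underS s" "set xs \<subseteq> underS a" by auto
    obtain n where n: "x \<in> underS (g n)"
      using cofinal_sequence_above(2)[OF assms(1)] Cons.prems by auto
    have gn: "g n \<in> underS s" using cofinal_sequence_above(1)[OF assms(1)] .
    then consider "x \<in> underS a" | "a \<in> underS (g n)"
      using a(1) n underS_cases[of a "g n"] underS_sub underS_trans by blast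
    then show ?case
    proof cases
      case 1
      then show ?thesis using a by (intro bexI[of _ a]) auto
    next
      case 2
      then have "set xs \<subseteq> underS (g n)" using a(2) underS_trans by blast
      then show ?thesis using n gn by (intro bexI[of _ "g n"]) auto
    qed
  qed
  then show ?thesis using that by blast
qed


section \<open>Tree-decompositions of \<open>G(S)\<close> into small parts\<close>

lemma card_verts_GS:
  assumes "S \<subseteq> Field \<kappa>"
  shows "|verts (GS \<kappa> S f)| \<le>o \<kappa>"
proof -
  have "|S| \<le>o \<kappa>"
    using ordLeq_ordIso_trans[OF card_of_mono1[OF assms] card_of_Field_ordIso[OF card]] .
  then have "|OmegaSeq ` f ` S| \<le>o \<kappa>"
    using ordLeq_transitive[OF card_of_image ordLeq_transitive[OF card_of_image]] by blast
  moreover have "|FinSeq ` lists (Field \<kappa>)| \<le>o \<kappa>"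
    using ordLeq_transitive[OF card_of_image lists_Field] .
  ultimately show ?thesis
    unfolding GS_def using card_of_Un_ordLeq_infinite_Field[OF infinite_Field _ _ card] by simp
qed

lemma no_small_tree_decomposition:
  assumes stat: "stationary \<kappa> S"
    and cof: "\<And>s. s \<in> S \<Longrightarrow> cofinal_sequence \<kappa> s (f s)"
    and td: "tree_decomposition (GS \<kappa> S f) Q V"
    and small: "\<And>q. q \<in> verts Q \<Longrightarrow> |V q| <o \<kappa>"
  shows False
proof -
  let ?G = "GS \<kappa> S f"
  have SF: "S \<subseteq> Field \<kappa>" using stat unfolding stationary_def by blast
  note ne = tree_decompositionD(1)[OF td] and conn = tree_decompositionD(2)[OF td]
    and V = tree_decompositionD(3)[OF td] and edge = tree_decompositionD(4)[OF td]
  obtain q0 where q0: "q0 \<in> verts Q" using ne by blast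
  have "\<exists>p. is_path Q q0 p (last p) \<and> FinSeq x \<in> V (last p)" if "x \<in> lists (Field \<kappa>)" for x
  proof -
    have "FinSeq x \<in> verts ?G" using that by (simp add: GS_def)
    then obtain q where "q \<in> verts Q" "FinSeq x \<in> V q" using V by blast
    then show ?thesis using conn[OF q0] unfolding is_path_def by metis
  qed
  then obtain P where P: "\<And>x. x \<in> lists (Field \<kappa>) \<Longrightarrow> is_path Q q0 (P x) (last (P x))"
    "\<And>x. x \<in> lists (Field \<kappa>) \<Longrightarrow> FinSeq x \<in> V (last (P x))"
    by metis
  define T where "T a = (\<Union>x\<in>lists (underS a). set (P x))" for a
  define X where "X a = (\<Union>q\<in>T a. V q)" for a
  define E where "E a = (\<Union>v\<in>X a. case v of FinSeq xs \<Rightarrow> set xs | OmegaSeq g \<Rightarrow> {t \<in> S. f t = g})" for a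
  \<comment> \<open>\<open>T a\<close>, \<open>X a\<close> and \<open>E a\<close> have fewer than \<open>\<kappa>\<close> elements; for \<open>E a\<close> this needs that each infinite
    sequence is \<open>f t\<close> for at most one \<open>t \<in> S\<close>.\<close>
  have lF: "x \<in> lists (Field \<kappa>)" if "x \<in> lists (underS a)" for x a
    using that underS_sub[of a] by auto
  have TQ: "T a \<subseteq> verts Q" for a
    using P(1)[OF lF] unfolding T_def is_path_def by blast
  have XG: "X a \<subseteq> verts ?G" for a using TQ V unfolding X_def by blast
  have "|T a| <o \<kappa>" if "a \<in> Field \<kappa>" for a
    unfolding T_def
    by (rule stable_UNION[OF stable lists_small[OF card_of_underS[OF card that]] finite_small]) simp
  then have Xs: "|X a| <o \<kappa>" if "a \<in> Field \<kappa>" for a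
    unfolding X_def using that small TQ by (intro stable_UNION[OF stable]) blast+
  have "finite (case v of FinSeq xs \<Rightarrow> set xs | OmegaSeq g \<Rightarrow> {t \<in> S. f t = g})" for v
  proof (cases v)
    case (OmegaSeq g)
    have "t = t'" if "t \<in> S" "t' \<in> S" "f t = g" "f t' = g" for t t'
      using cofinal_sequence_inj[OF cof[OF that(1)]] cof[OF that(2)] that SF by auto
    then obtain t where "{t \<in> S. f t = g} \<subseteq> {t}" by blast
    then have "finite {t \<in> S. f t = g}" by (rule finite_subset) simp
    then show ?thesis using OmegaSeq by simp
  qed simp
  then have Es: "|E a| <o \<kappa>" if "a \<in> Field \<kappa>" for a
    unfolding E_def by (rule stable_UNION[OF stable Xs[OF that] finite_small])
  have EF: "E a \<subseteq> Field \<kappa>" for a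
    using XG SF unfolding E_def GS_def by (fastforce split: vertex.splits)
  have h: "suc (E a) \<in> Field \<kappa>" "\<And>b. b \<in> E a \<Longrightarrow> b \<in> underS (suc (E a))"
    if "a \<in> Field \<kappa>" for a
    using small_below_suc[OF EF Es[OF that]] by auto
  obtain s where s: "s \<in> S" "\<And>a. a \<in> underS s \<Longrightarrow> suc (E a) \<in> underS s"
    using stationary_closure_point[OF stat, of "\<lambda>a. suc (E a)"] h(1)
    unfolding image_subset_iff by blast
  have Eb: "\<exists>c\<in>underS s. E a \<subseteq> underS c" if "a \<in> underS s" for a
    using s(2)[OF that] h(2)[of a] that underS_sub[of s] by blast
  note cs = cof[OF s(1)]
  \<comment> \<open>Continuity of \<open>T\<close> at \<open>s\<close>, by finiteness of the sequences that define it.\<close>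
  have cont: "\<exists>a\<in>underS s. q \<in> T a" if q: "q \<in> T s" for q
  proof -
    obtain x where x: "x \<in> lists (underS s)" "q \<in> set (P x)" using q unfolding T_def by blast
    then obtain a where "a \<in> underS s" "set x \<subseteq> underS a"
      using list_bounded_below[OF cs, of x] by auto
    then show ?thesis using x(2) unfolding T_def by (auto simp: in_lists_conv_set)
  qed
  let ?x = "\<lambda>n. map (f s) [0..<n]"
  let ?v = "OmegaSeq (f s)"
  have out: "?v \<notin> X s"
  proof
    assume "?v \<in> X s"
    then obtain q where "q \<in> T s" "?v \<in> V q" unfolding X_def by blast
    then obtain a where a: "a \<in> underS s" "?v \<in> X a" using cont unfolding X_def by blast
    then have "s \<in> E a" using s(1) unfolding E_def by force
    then show False using Eb[OF a(1)] underS_asym by blast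
  qed
  have x: "?x n \<in> lists (underS s)" for n
    using cofinal_sequence_above(1)[OF cs] by auto
  have "\<exists>r\<in>verts Q. {?v, FinSeq (?x n)} \<subseteq> V r" for n
    using s(1) by (intro edge) (auto simp: GS_def)
  then obtain r where r: "\<And>n. r n \<in> verts Q" "\<And>n. ?v \<in> V (r n)" "\<And>n. FinSeq (?x n) \<in> V (r n)"
    by (metis insert_subset)
  have Tne: "last (P y) \<in> T s" if "y \<in> lists (underS s)" for y
    using that P(1)[OF lF[OF that]] last_in_set[of "P y"] unfolding T_def is_path_def by blast
  have root: "(q0, q) \<in> joined Q (T s)" if q: "q \<in> T s" for q
  proof -
    obtain y where y: "y \<in> lists (underS s)" "q \<in> set (P y)" using q unfolding T_def by blast
    have "set (P y) \<subseteq> T s" using y(1) unfolding T_def by blast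
    then show ?thesis
      using successively_joined_hd y(2) P(1)[OF lF[OF y(1)]] unfolding is_path_def by metis
  qed
  have notin: "r n \<notin> T s" for n using r(2) out unfolding X_def by blast
  obtain q where q: "q \<in> T s"
    "\<And>c d. c \<in> T s \<Longrightarrow> (r 0, d) \<in> joined Q (verts Q - T s) \<Longrightarrow> V c \<inter> V d \<subseteq> V q"
  proof (rule gate_separates[OF td TQ[of s], of "r 0"])
    show "(u, v) \<in> joined Q (T s)" if "u \<in> T s" "v \<in> T s" for u v
      using joined_trans[OF joined_sym[OF root[OF that(1)]] root[OF that(2)]] .
  qed (use Tne[OF x] r(1) notin in auto)
  \<comment> \<open>All the parts \<open>V (r n)\<close> contain \<open>f s\<close>, so all the \<open>r n\<close> lie behind the gate of \<open>r 0\<close>.\<close>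
  have xq: "FinSeq (?x n) \<in> V q" for n
  proof -
    have "(r 0, r n) \<in> joined Q (verts Q - T s)"
      using joined_outside[OF td r(2) r(2) r(1) r(1)] out unfolding X_def by blast
    from q(2)[OF Tne[OF x] this, of n] show ?thesis using P(2)[OF lF[OF x]] r(3) by blast
  qed
  obtain a where a: "a \<in> underS s" "q \<in> T a" using cont q(1) by blast
  have fE: "f s n \<in> E a" for n
    \<comment> \<open>\<open>f s n\<close> is the last entry of the initial segment of length \<open>n + 1\<close>.\<close>
    using xq[of "Suc n"] a(2) unfolding E_def X_def by force
  obtain c where c: "c \<in> underS s" "E a \<subseteq> underS c" using Eb[OF a(1)] by blast
  obtain n where "c \<in> underS (f s n)" using cofinal_sequence_above(2)[OF cs c(1)] by blast
  then show False using fE c(2) underS_asym by blast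
qed

end

text \<open>Since \<open>G(S)\<close> has at most \<open>\<kappa>\<close> vertices, a part whose size is not \<open>\<kappa>\<close> is smaller than \<open>\<kappa>\<close>.\<close>

theorem theorem2:
  fixes \<kappa> :: "'a rel" and S :: "'a set" and f :: "'a \<Rightarrow> nat \<Rightarrow> 'a"
    and Q :: "'q ugraph" and V :: "'q \<Rightarrow> 'a vertex set"
  assumes "Card_order \<kappa>" and "natLeq <o \<kappa>" and "regularCard \<kappa>"
    and "stationary \<kappa> S"
    and "\<And>s. s \<in> S \<Longrightarrow> has_cofinality \<kappa> s natLeq"
    and "\<And>s. s \<in> S \<Longrightarrow> cofinal_sequence \<kappa> s (f s)"
    and "tree_decomposition (GS \<kappa> S f) Q V"
  shows "\<exists>q\<in>verts Q. |V q| =o \<kappa>"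
proof (rule ccontr)
  interpret regular_uncountable \<kappa> using assms(1-3) by unfold_locales
  assume no: "\<not> (\<exists>q\<in>verts Q. |V q| =o \<kappa>)"
  have "S \<subseteq> Field \<kappa>" using assms(4) unfolding stationary_def by blast
  have "|V q| <o \<kappa>" if "q \<in> verts Q" for q
  proof -
    have "V q \<subseteq> verts (GS \<kappa> S f)"
      using tree_decompositionD(3)[OF assms(7)] that by blast
    then have "|V q| \<le>o \<kappa>"
      using ordLeq_transitive[OF card_of_mono1 card_verts_GS[OF \<open>S \<subseteq> Field \<kappa>\<close>]] by blast
    then show ?thesis using no that ordLeq_iff_ordLess_or_ordIso by blast
  qed
  then show False using no_small_tree_decomposition[OF assms(4,6,7)] by blast
qed

end
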